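(* Let $X$ be a unital operator space with unit $1$ and let $x\in X$ satisfy $\|x\|\leq 1$. Then $x$ is dissipative if and only if $$\|1+tx\|^2\leq 1+t^2\quad\text{for all } t\in[0,1].$$ Consequently, if $X$ is a unital operator space with a Banach space predual, then the set $D_X$ of all dissipative elements of $X$ is weak* closed.
   Context: A unital operator space is a vector space of operators on a Hilbert space $H$ containing the identity operator $1=I_H$ (not necessarily selfadjoint). A state on $X$ is a functional $\rho\in X^{\sharp}$ (the Banach space dual) with $\rho(1)=\|\rho\|=1$. The numerical range of $x\in X$ is $\{\rho(x):\rho \text{ a state on } X\}$; $x$ is dissipative if its numerical range is contained in the closed left half-plane $\{z\in\mathbb{C}:\mathrm{Re}\, z\leq 0\}$. $X$ has a Banach space predual if it is isometrically isomorphic to the dual of a Banach space $X_{\sharp}$; the weak* topology on $X$ is then $\sigma(X,X_{\sharp})$. *)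

theory Defs
  imports "HOL-Analysis.Analysis"
begin

class complex_vector = real_vector +
  fixes scaleC :: "complex \<Rightarrow> 'a \<Rightarrow> 'a" (infixr "*\<^sub>C" 75)
  assumes scaleR_scaleC: "r *\<^sub>R x = complex_of_real r *\<^sub>C x"
    and scaleC_add_right: "a *\<^sub>C (x + y) = a *\<^sub>C x + a *\<^sub>C y"
    and scaleC_add_left: "(a + b) *\<^sub>C x = a *\<^sub>C x + b *\<^sub>C x"
    and scaleC_scaleC: "a *\<^sub>C (b *\<^sub>C x) = (a * b) *\<^sub>C x"
    and scaleC_one: "1 *\<^sub>C x = x"

global_interpretation complex_vector:
  vector_space "scaleC :: complex \<Rightarrow> 'a \<Rightarrow> 'a::complex_vector"
  by unfold_locales (rule scaleC_add_right scaleC_add_left scaleC_scaleC scaleC_one)+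

class complex_normed_vector = complex_vector + real_normed_vector +
  assumes norm_scaleC: "norm (a *\<^sub>C x) = cmod a * norm x"

text \<open>The inner product is linear in its first argument. A complex Hilbert space is a type of sort
  \<open>{complex_inner, complete_space}\<close>, a complex Banach space one of sort
  \<open>{complex_normed_vector, complete_space}\<close>.\<close>

class complex_inner = complex_normed_vector +
  fixes cinner :: "'a \<Rightarrow> 'a \<Rightarrow> complex"
  assumes cinner_commute: "cinner x y = cnj (cinner y x)"
    and cinner_add_left: "cinner (x + y) z = cinner x z + cinner y z"
    and cinner_scaleC_left: "cinner (a *\<^sub>C x) y = a * cinner x y"
    and cinner_self: "cinner x x = complex_of_real ((norm x)\<^sup>2)"

instantiation complex :: complex_inner
begin

definition scaleC_complex :: "complex \<Rightarrow> complex \<Rightarrow> complex"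
  where "scaleC_complex a x = a * x"

definition cinner_complex :: "complex \<Rightarrow> complex \<Rightarrow> complex"
  where "cinner_complex x y = x * cnj y"

instance
  by standard
    (auto simp: scaleC_complex_def cinner_complex_def algebra_simps norm_mult scaleR_conv_of_real
      simp flip: complex_norm_square)

end

lemma bounded_linear_scaleC_right:
  "bounded_linear (\<lambda>x. a *\<^sub>C (x :: 'a::complex_normed_vector))"
  by (rule bounded_linear_intro[of _ "cmod a"])
    (simp_all add: scaleC_add_right scaleR_scaleC scaleC_scaleC norm_scaleC mult.commute)

text \<open>Bounded \<^emph>\<open>real\<close>-linear maps form the library type \<open>blinfun\<close>, whose norm is the
  operator norm; pointwise multiplication makes it a complex space. Complex linearity of the
  elements is imposed separately below, and the subspace of complex-linear maps has the same norm.\<close>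

instantiation blinfun :: (real_normed_vector, complex_normed_vector) complex_normed_vector
begin

definition scaleC_blinfun :: "complex \<Rightarrow> ('a \<Rightarrow>\<^sub>L 'b) \<Rightarrow> ('a \<Rightarrow>\<^sub>L 'b)"
  where "scaleC_blinfun a f = Blinfun (\<lambda>x. a *\<^sub>C blinfun_apply f x)"

lemma scaleC_blinfun_apply: "blinfun_apply (a *\<^sub>C f) x = a *\<^sub>C blinfun_apply f x"
  unfolding scaleC_blinfun_def
  by (subst bounded_linear_Blinfun_apply)
    (auto intro: bounded_linear_compose[OF bounded_linear_scaleC_right] blinfun.bounded_linear_right)

instance
proof
  fix a b :: complex and r :: real and f g :: "'a \<Rightarrow>\<^sub>L 'b"
  show "r *\<^sub>R f = complex_of_real r *\<^sub>C f"
    by (rule blinfun_eqI) (simp add: scaleC_blinfun_apply blinfun.scaleR_left scaleR_scaleC)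
  show "a *\<^sub>C (f + g) = a *\<^sub>C f + a *\<^sub>C g"
    by (rule blinfun_eqI) (simp add: scaleC_blinfun_apply blinfun.add_left scaleC_add_right)
  show "(a + b) *\<^sub>C f = a *\<^sub>C f + b *\<^sub>C f"
    by (rule blinfun_eqI) (simp add: scaleC_blinfun_apply blinfun.add_left scaleC_add_left)
  show assoc: "a *\<^sub>C (b *\<^sub>C f) = (a * b) *\<^sub>C f" for a b and f :: "'a \<Rightarrow>\<^sub>L 'b"
    by (rule blinfun_eqI) (simp add: scaleC_blinfun_apply scaleC_scaleC)
  show one: "1 *\<^sub>C f = f" for f :: "'a \<Rightarrow>\<^sub>L 'b"
    by (rule blinfun_eqI) (simp add: scaleC_blinfun_apply scaleC_one)
  have le: "norm (a *\<^sub>C f) \<le> cmod a * norm f" for a and f :: "'a \<Rightarrow>\<^sub>L 'b"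
  proof (rule norm_blinfun_bound)
    fix x
    have "cmod a * norm (blinfun_apply f x) \<le> cmod a * (norm f * norm x)"
      by (intro mult_left_mono norm_blinfun) simp
    then show "norm (blinfun_apply (a *\<^sub>C f) x) \<le> cmod a * norm f * norm x"
      by (simp add: scaleC_blinfun_apply norm_scaleC mult.assoc)
  qed simp
  show "norm (a *\<^sub>C f) = cmod a * norm f"
  proof (cases "a = 0")
    case True
    then show ?thesis using le[of 0 f] by simp
  next
    case False
    have "norm f = norm (inverse a *\<^sub>C (a *\<^sub>C f))"
      using False by (simp add: assoc one)
    also have "\<dots> \<le> norm (a *\<^sub>C f) / cmod a"
      using le[of "inverse a" "a *\<^sub>C f"] by (simp add: norm_inverse divide_inverse mult.commute)
    finally show ?thesis
      using False le[of a f] by (simp add: field_simps)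
  qed
qed

end

definition clinear_on :: "'a::complex_vector set \<Rightarrow> ('a \<Rightarrow> 'b::complex_vector) \<Rightarrow> bool"
  where "clinear_on S f \<longleftrightarrow>
    (\<forall>x\<in>S. \<forall>y\<in>S. f (x + y) = f x + f y) \<and> (\<forall>a. \<forall>x\<in>S. f (a *\<^sub>C x) = a *\<^sub>C f x)"

definition unital_operator_space :: "('h::{complex_inner, complete_space} \<Rightarrow>\<^sub>L 'h) set \<Rightarrow> bool"
  where "unital_operator_space X \<longleftrightarrow>
    (\<forall>T\<in>X. clinear_on UNIV (blinfun_apply T)) \<and>
    complex_vector.subspace X \<and> id_blinfun \<in> X"

text \<open>Functionals on a subspace \<open>X\<close> are functions on the ambient type; their values outside \<open>X\<close>
  are irrelevant.\<close>

definition bounded_functional_on :: "'a::complex_normed_vector set \<Rightarrow> ('a \<Rightarrow> complex) \<Rightarrow> bool"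
  where "bounded_functional_on X \<rho> \<longleftrightarrow>
    clinear_on X \<rho> \<and> (\<exists>K. \<forall>x\<in>X. cmod (\<rho> x) \<le> K * norm x)"

definition functional_norm :: "'a::complex_normed_vector set \<Rightarrow> ('a \<Rightarrow> complex) \<Rightarrow> real"
  where "functional_norm X \<rho> = (SUP x\<in>{x\<in>X. norm x \<le> 1}. cmod (\<rho> x))"

definition state_on ::
    "('h::{complex_inner, complete_space} \<Rightarrow>\<^sub>L 'h) set \<Rightarrow> (('h \<Rightarrow>\<^sub>L 'h) \<Rightarrow> complex) \<Rightarrow> bool"
  where "state_on X \<rho> \<longleftrightarrow>
    bounded_functional_on X \<rho> \<and> \<rho> id_blinfun = 1 \<and> functional_norm X \<rho> = 1"

definition numerical_range ::
    "('h::{complex_inner, complete_space} \<Rightarrow>\<^sub>L 'h) set \<Rightarrow> ('h \<Rightarrow>\<^sub>L 'h) \<Rightarrow> complex set"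
  where "numerical_range X x = {\<rho> x | \<rho>. state_on X \<rho>}"

definition dissipative ::
    "('h::{complex_inner, complete_space} \<Rightarrow>\<^sub>L 'h) set \<Rightarrow> ('h \<Rightarrow>\<^sub>L 'h) \<Rightarrow> bool"
  where "dissipative X x \<longleftrightarrow> numerical_range X x \<subseteq> {z. Re z \<le> 0}"

definition cdual :: "('p::complex_normed_vector \<Rightarrow>\<^sub>L complex) set"
  where "cdual = {f. clinear_on UNIV (blinfun_apply f)}"

text \<open>\<open>is_predual X \<Phi>\<close>: the Banach space \<open>'p\<close> is a predual of \<open>X\<close> via the isometric
  isomorphism \<open>\<Phi>\<close> of \<open>X\<close> onto the dual of \<open>'p\<close>.\<close>

definition is_predual ::
    "'a::complex_normed_vector set \<Rightarrow>
      ('a \<Rightarrow> ('p::{complex_normed_vector, complete_space} \<Rightarrow>\<^sub>L complex)) \<Rightarrow> bool"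
  where "is_predual X \<Phi> \<longleftrightarrow>
    clinear_on X \<Phi> \<and> bij_betw \<Phi> X cdual \<and> (\<forall>x\<in>X. norm (\<Phi> x) = norm x)"

text \<open>The weak* topology \<open>\<sigma>(X, 'p)\<close>: the coarsest topology on \<open>X\<close> for which all the functions
  \<open>x \<mapsto> \<Phi> x p\<close> are continuous.\<close>

definition weak_star_topology ::
    "'a::complex_normed_vector set \<Rightarrow>
      ('a \<Rightarrow> ('p::{complex_normed_vector, complete_space} \<Rightarrow>\<^sub>L complex)) \<Rightarrow> 'a topology"
  where "weak_star_topology X \<Phi> =
    topology_generated_by {{x\<in>X. blinfun_apply (\<Phi> x) p \<in> U} | p U. open U}"

end

theory Submission
  imports Defs
begin

text \<open>For a unit vector \<open>\<xi>\<close> of the Hilbert space,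
  \<open>\<parallel>\<xi> + t x\<xi>\<parallel>\<^sup>2 = 1 + 2 t Re \<langle>x\<xi>, \<xi>\<rangle> + t\<^sup>2 \<parallel>x\<xi>\<parallel>\<^sup>2\<close>. If \<open>x\<close> is dissipative, the
  vector state of \<open>\<xi>\<close> makes the middle term nonpositive, whence
  \<open>\<parallel>1 + t x\<parallel>\<^sup>2 \<le> 1 + t\<^sup>2 \<parallel>x\<parallel>\<^sup>2\<close> for \<open>t \<ge> 0\<close> (\<open>dissipative_imp_norm_le\<close>). Conversely, a
  bound \<open>\<parallel>1 + t x\<parallel>\<^sup>2 \<le> 1 + O(t\<^sup>2)\<close> at \<open>t = 0\<close> controls \<open>Re \<rho>(x)\<close> to first order for every
  state \<open>\<rho>\<close> (\<open>dissipative_if_norm_le\<close>). This is the metric characterization.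

  It shows at once that the dissipative elements of each ball form a weak* closed set, as
  the norm is weak* lower semicontinuous, and the Krein-Smulian theorem would then remove the
  restriction to balls. The proof below takes another route, which exhibits the weak* closed
  half-spaces that cut out \<open>D\<^sub>X\<close>: those given by the positive elements of the predual, that is, by the \<open>p\<close> with
  \<open>Re p(1) = \<parallel>p\<parallel>\<close>. They are nonnegative multiples of states, so \<open>Re p \<le> 0\<close> on \<open>D\<^sub>X\<close>
  (\<open>dissipative_Re_nonpos\<close>), and it remains to find, for each \<open>x\<close> outside \<open>D\<^sub>X\<close>, one with
  \<open>Re p(x) > 0\<close> (\<open>not_dissipative_detected_by_predual\<close>).

  A vector \<open>p\<close> of the predual that nearly norms \<open>1 + t x\<close> for small \<open>t\<close>, with \<open>x\<close> not dissipative, has \<open>Re p(x) > 0\<close> and is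
  almost positive: \<open>Re p(1) \<ge> (1 - \<delta>) \<parallel>p\<parallel>\<close>. It is moved to a positive element at distance
  \<open>O(sqrt \<delta>)\<close> as follows. For any \<open>\<epsilon> > 0\<close> the condition with \<open>\<epsilon>\<close> in place of \<open>\<delta>\<close> defines a
  convex cone, and by Hahn-Banach the distance of \<open>p\<close> to it is the value at \<open>p\<close> of a contractive
  functional that is nonpositive on the cone. As \<open>X\<close> is the whole dual, this functional is an
  \<open>y \<in> X\<close>; it is dissipative because the cone, however small \<open>\<epsilon>\<close> is, contains all vectors that
  nearly norm \<open>1 + t y\<close> for small \<open>t\<close>, apart from those on which \<open>1 + t y\<close> has real part at most one. The metric
  characterization then gives \<open>Re p(y) = O(sqrt \<delta>)\<close>, uniformly in \<open>\<epsilon>\<close>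
  (\<open>infdist_approx_positive_le\<close>). Iterating with geometrically decreasing \<open>\<epsilon>\<close> and using
  completeness of the predual yields the positive element
  (\<open>positive_near_approx_positive\<close>).\<close>

section \<open>Dissipativity and the norm\<close>

lemma norm_add_scaleR_power2:
  fixes u v :: "'h::complex_inner"
  shows "(norm (u + t *\<^sub>R v))\<^sup>2 = (norm u)\<^sup>2 + 2 * t * Re (cinner v u) + t\<^sup>2 * (norm v)\<^sup>2"
proof -
  have add_right: "cinner x (y + z) = cinner x y + cinner x z" for x y z :: 'h
    by (metis cinner_commute cinner_add_left complex_cnj_add)
  have scale_right: "cinner x (a *\<^sub>C y) = cnj a * cinner x y" for x y :: 'h and a
    by (metis cinner_commute cinner_scaleC_left complex_cnj_mult)
  have sym: "Re (cinner u v) = Re (cinner v u)"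
    using cinner_commute[of u v] by simp
  have "complex_of_real ((norm (u + t *\<^sub>R v))\<^sup>2) = cinner (u + t *\<^sub>R v) (u + t *\<^sub>R v)"
    by (simp only: cinner_self)
  also have "\<dots> = complex_of_real ((norm u)\<^sup>2) + t * cinner v u + t * cinner u v
      + complex_of_real (t\<^sup>2 * (norm v)\<^sup>2)"
    unfolding scaleR_scaleC
    by (simp add: add_right scale_right cinner_add_left cinner_scaleC_left
        cinner_self[of u] cinner_self[of v] power2_eq_square algebra_simps)
  finally have "Re (complex_of_real ((norm (u + t *\<^sub>R v))\<^sup>2)) = Re (\<dots>)"
    by simp
  then show ?thesis
    by (simp add: sym)
qed

lemma scaleC_rotate:
  fixes f :: "'a::complex_vector \<Rightarrow> complex"
  assumes "\<And>a v. f (a *\<^sub>C v) = a * f v"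
  obtains c where "cmod c = 1" and "f (c *\<^sub>C v) = complex_of_real (cmod (f v))"
proof (cases "f v = 0")
  case True
  with that[of 1] assms[of 1 v] show thesis by simp
next
  case False
  have "cnj (sgn (f v)) * f v = complex_of_real (cmod (f v))"
    using False complex_norm_square[of "f v"] by (simp add: sgn_eq field_simps power2_eq_square)
  with that[of "cnj (sgn (f v))"] assms False show thesis
    by (simp add: norm_sgn)
qed

text \<open>The Cauchy-Schwarz inequality is the triangle inequality, squared: this gives the real part,
  and a rotation of \<open>u\<close> gives the modulus.\<close>

lemma cmod_cinner_le:
  fixes u v :: "'h::complex_inner"
  shows "cmod (cinner u v) \<le> norm u * norm v"
proof -
  have re: "Re (cinner w v) \<le> norm w * norm v" for w
  proof -
    have "(norm (v + 1 *\<^sub>R w))\<^sup>2 \<le> (norm v + norm w)\<^sup>2"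
      by (rule power_mono) (simp_all add: norm_triangle_ineq)
    then show ?thesis
      unfolding norm_add_scaleR_power2 by (simp add: power2_sum mult.commute)
  qed
  obtain c where "cmod c = 1" "cinner (c *\<^sub>C u) v = complex_of_real (cmod (cinner u v))"
    by (rule scaleC_rotate[of "\<lambda>w. cinner w v"]) (rule cinner_scaleC_left)
  with re[of "c *\<^sub>C u"] show ?thesis
    by (simp add: norm_scaleC)
qed

lemma vector_state:
  fixes \<xi> :: "'h::{complex_inner, complete_space}"
  assumes X: "unital_operator_space X" and "norm \<xi> = 1"
  shows "state_on X (\<lambda>T. cinner (blinfun_apply T \<xi>) \<xi>)"
proof -
  let ?\<rho> = "\<lambda>T. cinner (blinfun_apply T \<xi>) \<xi>"
  have le: "cmod (?\<rho> T) \<le> norm T" for T :: "'h \<Rightarrow>\<^sub>L 'h"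
    using cmod_cinner_le[of "blinfun_apply T \<xi>" \<xi>] norm_blinfun[of T \<xi>] assms(2) by simp
  have one: "?\<rho> id_blinfun = 1"
    using assms(2) by (simp add: cinner_self)
  have id: "(id_blinfun :: 'h \<Rightarrow>\<^sub>L 'h) \<in> X" "norm (id_blinfun :: 'h \<Rightarrow>\<^sub>L 'h) \<le> 1"
    using X unfolding unital_operator_space_def by (auto intro: norm_blinfun_bound)
  have "functional_norm X ?\<rho> = 1"
    unfolding functional_norm_def
  proof (rule cSup_eq_maximum)
    show "1 \<in> (\<lambda>T. cmod (?\<rho> T)) ` {x \<in> X. norm x \<le> 1}"
      using id one by (auto intro!: image_eqI[of _ _ id_blinfun])
    show "y \<le> 1" if "y \<in> (\<lambda>T. cmod (?\<rho> T)) ` {x \<in> X. norm x \<le> 1}" for y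
      using that le order_trans by blast
  qed
  moreover have "bounded_functional_on X ?\<rho>"
    unfolding bounded_functional_on_def clinear_on_def using le
    by (auto simp: blinfun.add_left cinner_add_left scaleC_blinfun_apply cinner_scaleC_left
        scaleC_complex_def intro!: exI[of _ 1])
  ultimately show ?thesis
    unfolding state_on_def using one by simp
qed

lemma state_on_cmod_le:
  assumes X: "unital_operator_space X" and \<rho>: "state_on X \<rho>" and x: "x \<in> X"
  shows "cmod (\<rho> x) \<le> norm x"
proof -
  have lin: "clinear_on X \<rho>"
    using \<rho> unfolding state_on_def bounded_functional_on_def by blast
  show ?thesis
  proof (cases "x = 0")
    case True
    have "\<rho> (0 *\<^sub>C x) = 0 *\<^sub>C \<rho> x"
      using lin x unfolding clinear_on_def by blast
    with True show ?thesis by (simp add: scaleC_complex_def)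
  next
    case False
    let ?a = "complex_of_real (inverse (norm x))"
    obtain K where K: "\<And>y. y \<in> X \<Longrightarrow> cmod (\<rho> y) \<le> K * norm y"
      using \<rho> unfolding state_on_def bounded_functional_on_def by blast
    have "bdd_above ((\<lambda>y. cmod (\<rho> y)) ` {y \<in> X. norm y \<le> 1})"
    proof (rule bdd_aboveI2[where M = "\<bar>K\<bar>"])
      fix y assume y: "y \<in> {y \<in> X. norm y \<le> 1}"
      then have "cmod (\<rho> y) \<le> K * norm y" using K by blast
      also have "\<dots> \<le> \<bar>K\<bar> * 1" using y by (intro mult_mono) auto
      finally show "cmod (\<rho> y) \<le> \<bar>K\<bar>" by simp
    qed
    moreover have ax: "?a *\<^sub>C x \<in> X"
      using X x unfolding unital_operator_space_def
      by (simp add: complex_vector.subspace_scale)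
    moreover have "norm (?a *\<^sub>C x) \<le> 1"
      using False by (simp add: norm_scaleC norm_inverse)
    ultimately have "cmod (\<rho> (?a *\<^sub>C x)) \<le> functional_norm X \<rho>"
      unfolding functional_norm_def by (intro cSUP_upper) auto
    moreover have "\<rho> (?a *\<^sub>C x) = ?a * \<rho> x"
      using lin x unfolding clinear_on_def scaleC_complex_def by blast
    moreover have "functional_norm X \<rho> = 1"
      using \<rho> unfolding state_on_def by blast
    ultimately have "cmod (?a * \<rho> x) \<le> 1"
      by simp
    then show ?thesis
      using False by (simp add: norm_mult norm_inverse norm_divide field_simps)
  qed
qed

lemma unital_operator_space_add_scaleR:
  assumes "unital_operator_space X" "x \<in> X"
  shows "id_blinfun + t *\<^sub>R x \<in> X"
  using assms unfolding unital_operator_space_def scaleR_scaleC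
  by (simp add: complex_vector.subspace_add complex_vector.subspace_scale)

lemma state_on_add_scaleR:
  assumes X: "unital_operator_space X" and \<rho>: "state_on X \<rho>" and x: "x \<in> X"
  shows "\<rho> (id_blinfun + t *\<^sub>R x) = 1 + complex_of_real t * \<rho> x"
proof -
  have id: "id_blinfun \<in> X" and tx: "complex_of_real t *\<^sub>C x \<in> X"
    using X x unfolding unital_operator_space_def by (auto intro: complex_vector.subspace_scale)
  have lin: "clinear_on X \<rho>" and one: "\<rho> id_blinfun = 1"
    using \<rho> unfolding state_on_def bounded_functional_on_def by auto
  have "\<rho> (id_blinfun + complex_of_real t *\<^sub>C x) = \<rho> id_blinfun + \<rho> (complex_of_real t *\<^sub>C x)"
    using lin id tx unfolding clinear_on_def by blast
  also have "\<rho> (complex_of_real t *\<^sub>C x) = complex_of_real t * \<rho> x"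
    using lin x unfolding clinear_on_def scaleC_complex_def by blast
  finally show ?thesis
    by (simp add: one scaleR_scaleC)
qed

text \<open>Vector states suffice: for a unit vector \<open>\<xi>\<close> the cross term
  in \<open>\<parallel>\<xi> + t x\<xi>\<parallel>\<^sup>2\<close> is \<open>2 t Re \<langle>x\<xi>, \<xi>\<rangle> \<le> 0\<close>.\<close>

lemma dissipative_imp_norm_le:
  fixes X :: "('h::{complex_inner, complete_space} \<Rightarrow>\<^sub>L 'h) set"
  assumes X: "unital_operator_space X" and diss: "dissipative X x" and t: "0 \<le> t"
  shows "(norm (id_blinfun + t *\<^sub>R x))\<^sup>2 \<le> 1 + t\<^sup>2 * (norm x)\<^sup>2"
proof -
  let ?c = "sqrt (1 + t\<^sup>2 * (norm x)\<^sup>2)"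
  have re: "Re (cinner (blinfun_apply x v) v) \<le> 0" for v
  proof (cases "v = 0")
    case True
    with cmod_cinner_le[of "blinfun_apply x v" v] show ?thesis by simp
  next
    case False
    define \<xi> where "\<xi> = v /\<^sub>R norm v"
    have v: "v = norm v *\<^sub>R \<xi>" and "norm \<xi> = 1"
      using False by (simp_all add: \<xi>_def)
    then have "cinner (blinfun_apply x \<xi>) \<xi> \<in> numerical_range X x"
      unfolding numerical_range_def using vector_state[OF X] by fastforce
    then have "Re (cinner (blinfun_apply x \<xi>) \<xi>) \<le> 0"
      using diss unfolding dissipative_def by blast
    moreover have "cinner (blinfun_apply x v) v
        = complex_of_real ((norm v)\<^sup>2) * cinner (blinfun_apply x \<xi>) \<xi>"
    proof -
      have "cinner (r *\<^sub>R u) (r *\<^sub>R w) = complex_of_real (r\<^sup>2) * cinner u w" for r and u w :: 'h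
        unfolding scaleR_scaleC
        by (subst cinner_scaleC_left, subst cinner_commute, subst cinner_scaleC_left,
            subst (2) cinner_commute) (simp add: power2_eq_square mult.assoc)
      then show ?thesis
        by (metis v blinfun.scaleR_right)
    qed
    ultimately show ?thesis
      by (simp add: mult_nonneg_nonpos)
  qed
  have "norm (id_blinfun + t *\<^sub>R x) \<le> ?c"
  proof (rule norm_blinfun_bound)
    fix v
    have "(norm (blinfun_apply (id_blinfun + t *\<^sub>R x) v))\<^sup>2
        = (norm v)\<^sup>2 + 2 * t * Re (cinner (blinfun_apply x v) v)
          + t\<^sup>2 * (norm (blinfun_apply x v))\<^sup>2"
      by (simp add: blinfun.add_left blinfun.scaleR_left norm_add_scaleR_power2)
    also have "\<dots> \<le> (norm v)\<^sup>2 + 0 + t\<^sup>2 * (norm x * norm v)\<^sup>2"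
      by (intro add_mono mult_left_mono power_mono norm_blinfun)
        (use re t in \<open>auto simp: mult_nonneg_nonpos\<close>)
    also have "\<dots> = (?c * norm v)\<^sup>2"
      by (simp add: power_mult_distrib algebra_simps)
    finally show "norm (blinfun_apply (id_blinfun + t *\<^sub>R x) v) \<le> ?c * norm v"
      by (rule power2_le_imp_le) simp
  qed simp
  then have "(norm (id_blinfun + t *\<^sub>R x))\<^sup>2 \<le> ?c\<^sup>2"
    by (rule power_mono) simp
  then show ?thesis by simp
qed

text \<open>A state satisfies \<open>|1 + t \<rho>(x)|\<^sup>2 \<le> \<parallel>1 + t x\<parallel>\<^sup>2\<close>, whose left-hand side is
  \<open>1 + 2 t Re \<rho>(x) + O(t\<^sup>2)\<close>; so an upper bound \<open>1 + O(t\<^sup>2)\<close> near \<open>t = 0\<close>, with any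
  constant, forces \<open>Re \<rho>(x) \<le> 0\<close>.\<close>

lemma dissipative_if_norm_le:
  assumes X: "unital_operator_space X" and x: "x \<in> X" and "0 < \<tau>"
    and le: "\<And>t. \<lbrakk>0 < t; t \<le> \<tau>\<rbrakk> \<Longrightarrow> (norm (id_blinfun + t *\<^sub>R x))\<^sup>2 \<le> 1 + C * t\<^sup>2"
  shows "dissipative X x"
  unfolding dissipative_def
proof clarify
  fix z assume "z \<in> numerical_range X x"
  then obtain \<rho> where \<rho>: "state_on X \<rho>" and z: "z = \<rho> x"
    unfolding numerical_range_def by blast
  have bound: "2 * Re z \<le> C * t" if t: "0 < t" "t \<le> \<tau>" for t
  proof -
    have "1 + 2 * t * Re z \<le> (1 + t * Re z)\<^sup>2"
      using zero_le_power2[of "t * Re z"] by (simp add: power2_eq_square algebra_simps)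
    also have "\<dots> = \<bar>Re (\<rho> (id_blinfun + t *\<^sub>R x))\<bar>\<^sup>2"
      by (simp add: state_on_add_scaleR[OF X \<rho> x] z)
    also have "\<dots> \<le> (norm (id_blinfun + t *\<^sub>R x))\<^sup>2"
      using abs_Re_le_cmod state_on_cmod_le[OF X \<rho> unital_operator_space_add_scaleR[OF X x]]
        order_trans by (intro power_mono) (blast, simp)
    finally have "1 + 2 * t * Re z \<le> 1 + C * t\<^sup>2"
      using le[OF t] by linarith
    then have "t * (2 * Re z) \<le> t * (C * t)"
      by (simp add: power2_eq_square algebra_simps)
    with t show ?thesis by simp
  qed
  have "((\<lambda>t. C * t) \<longlongrightarrow> C * 0) (at_right 0)"
    by (intro tendsto_intros)
  moreover have "\<forall>\<^sub>F t in at_right 0. 2 * Re z \<le> C * t"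
    using \<open>0 < \<tau>\<close> bound by (auto simp: eventually_at_right_field intro!: exI[of _ \<tau>])
  ultimately have "2 * Re z \<le> C * 0"
    by (rule tendsto_lowerbound) simp
  then show "Re z \<le> 0" by simp
qed

section \<open>Separation of a point from a convex cone\<close>

definition sublinear :: "('a::real_vector \<Rightarrow> real) \<Rightarrow> bool"
  where "sublinear g \<longleftrightarrow>
    (\<forall>v w. g (v + w) \<le> g v + g w) \<and> (\<forall>r>0. \<forall>v. g (r *\<^sub>R v) \<le> r * g v)"

lemma sublinear_add: "sublinear g \<Longrightarrow> g (v + w) \<le> g v + g w"
  unfolding sublinear_def by blast

lemma sublinear_scaleR:
  assumes g: "sublinear g" and "0 \<le> r"
  shows "g (r *\<^sub>R v) = r * g v"
proof (cases "r = 0")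
  case True
  have "g (2 *\<^sub>R 0) \<le> 2 * g 0" "g ((1/2) *\<^sub>R 0) \<le> 1/2 * g 0"
    using g unfolding sublinear_def by (metis zero_less_numeral, metis half_gt_zero zero_less_one)
  with True show ?thesis by simp
next
  case False
  with assms have "0 < r" by simp
  then have "g (r *\<^sub>R v) \<le> r * g v" "g (inverse r *\<^sub>R (r *\<^sub>R v)) \<le> inverse r * g (r *\<^sub>R v)"
    using g unfolding sublinear_def by (blast, meson positive_imp_inverse_positive)
  with \<open>0 < r\<close> show ?thesis by (simp add: field_simps)
qed

lemma sublinear_zero: "sublinear g \<Longrightarrow> g 0 = 0"
  using sublinear_scaleR[of g 0 0] by simp

lemma sublinear_minus: "sublinear g \<Longrightarrow> - g (- v) \<le> g v"
  using sublinear_add[of g v "- v"] by (simp add: sublinear_zero)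

text \<open>The largest sublinear minorant of \<open>g\<close> whose value at \<open>- v\<close> is at most \<open>- g v\<close>, so that
  every linear functional below it agrees with \<open>g\<close> at \<open>v\<close>. Both the linearity of
  minimal sublinear functionals and the attainment of a value come from this one construction.\<close>

definition lower_along :: "('a::real_vector \<Rightarrow> real) \<Rightarrow> 'a \<Rightarrow> 'a \<Rightarrow> real"
  where "lower_along g v w = (INF t\<in>{0..}. g (w + t *\<^sub>R v) - t * g v)"

lemma lower_along_le:
  assumes g: "sublinear g" and "0 \<le> t"
  shows "lower_along g v w \<le> g (w + t *\<^sub>R v) - t * g v"
  unfolding lower_along_def
proof (rule cINF_lower)
  have "- g (- w) \<le> g (w + s *\<^sub>R v) - s * g v" if "0 \<le> s" for s
    using sublinear_add[OF g, of "w + s *\<^sub>R v" "- w"] sublinear_scaleR[OF g that, of v] by simp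
  then show "bdd_below ((\<lambda>t. g (w + t *\<^sub>R v) - t * g v) ` {0..})"
    by (intro bdd_belowI2[where m = "- g (- w)"]) auto
qed (use assms in simp)

lemma lower_along_greatest:
  "(\<And>t. 0 \<le> t \<Longrightarrow> c \<le> g (w + t *\<^sub>R v) - t * g v) \<Longrightarrow> c \<le> lower_along g v w"
  unfolding lower_along_def by (intro cINF_greatest) auto

lemma sublinear_lower_along:
  assumes g: "sublinear g"
  shows "sublinear (lower_along g v)"
  unfolding sublinear_def
proof (intro conjI allI impI)
  fix w w'
  have "lower_along g v (w + w') - (g (w' + t *\<^sub>R v) - t * g v) \<le> g (w + s *\<^sub>R v) - s * g v"
    if "0 \<le> s" "0 \<le> t" for s t
    using lower_along_le[OF g, of "s + t" v "w + w'"] that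
      sublinear_add[OF g, of "w + s *\<^sub>R v" "w' + t *\<^sub>R v"]
    by (simp add: algebra_simps)
  then have "lower_along g v (w + w') - (g (w' + t *\<^sub>R v) - t * g v) \<le> lower_along g v w"
    if "0 \<le> t" for t
    using that by (intro lower_along_greatest)
  then have "lower_along g v (w + w') - lower_along g v w \<le> g (w' + t *\<^sub>R v) - t * g v"
    if "0 \<le> t" for t
    using that by (simp add: algebra_simps)
  then have "lower_along g v (w + w') - lower_along g v w \<le> lower_along g v w'"
    by (rule lower_along_greatest)
  then show "lower_along g v (w + w') \<le> lower_along g v w + lower_along g v w'"
    by simp
next
  fix r :: real and w assume r: "0 < r"
  have "inverse r * lower_along g v (r *\<^sub>R w) \<le> lower_along g v w"
  proof (rule lower_along_greatest)
    fix t :: real assume t: "0 \<le> t"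
    have "lower_along g v (r *\<^sub>R w) \<le> g (r *\<^sub>R w + (r * t) *\<^sub>R v) - (r * t) * g v"
      using r t by (intro lower_along_le[OF g]) simp
    also have "\<dots> = r * (g (w + t *\<^sub>R v) - t * g v)"
      using sublinear_scaleR[OF g, of r "w + t *\<^sub>R v"] r by (simp add: algebra_simps)
    finally show "inverse r * lower_along g v (r *\<^sub>R w) \<le> g (w + t *\<^sub>R v) - t * g v"
      using r by (simp add: field_simps)
  qed
  then show "lower_along g v (r *\<^sub>R w) \<le> r * lower_along g v w"
    using r by (simp add: field_simps)
qed

lemma lower_along_le_self: "sublinear g \<Longrightarrow> lower_along g v w \<le> g w"
  using lower_along_le[of g 0 v w] by simp

text \<open>By minimality \<open>lower_along g v\<close> is \<open>g\<close> itself for every \<open>v\<close>, which is superadditivity.\<close>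

lemma linear_if_minimal_sublinear:
  assumes g: "sublinear g" and min: "\<And>h. \<lbrakk>sublinear h; h \<le> g\<rbrakk> \<Longrightarrow> h = g"
  shows "linear g"
proof -
  have "lower_along g v = g" for v
    using min sublinear_lower_along[OF g] lower_along_le_self[OF g] by (simp add: le_fun_def)
  then have "g w + g v \<le> g (w + v)" for v w
    using lower_along_le[OF g, of 1 v w] by simp
  then have add: "g (v + w) = g v + g w" for v w
    using sublinear_add[OF g, of v w] by (simp add: antisym)
  have neg: "g (- v) = - g v" for v
    using add[of v "- v"] by (simp add: sublinear_zero[OF g])
  have "g (r *\<^sub>R v) = r * g v" for r v
  proof (cases "0 \<le> r")
    case False
    then have "g ((- r) *\<^sub>R v) = (- r) * g v"
      by (intro sublinear_scaleR[OF g]) simp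
    then show ?thesis by (simp add: neg)
  qed (rule sublinear_scaleR[OF g])
  with add show ?thesis
    by (intro linearI) simp_all
qed

text \<open>The Hahn-Banach theorem: Zorn's lemma gives a minimal sublinear minorant, as the pointwise
  infimum of a chain of sublinear functionals is again sublinear.\<close>

lemma linear_below_sublinear:
  fixes N :: "'a::real_vector \<Rightarrow> real"
  assumes N: "sublinear N"
  obtains f where "linear f" and "\<And>v. f v \<le> N v"
proof -
  let ?A = "{g. sublinear g \<and> g \<le> N}"
  let ?P = "\<lambda>g h :: 'a \<Rightarrow> real. h \<le> g"
  have "\<exists>m\<in>?A. \<forall>a\<in>?A. ?P m a \<longrightarrow> a = m"
  proof (rule predicate_Zorn)
    show "partial_order_on ?A (relation_of ?P ?A)"
      by (rule partial_order_on_relation_ofI) auto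
    fix C assume C: "C \<in> Chains (relation_of ?P ?A)"
    then have sub: "C \<subseteq> ?A" and tot: "\<And>g h. \<lbrakk>g \<in> C; h \<in> C\<rbrakk> \<Longrightarrow> g \<le> h \<or> h \<le> g"
      unfolding Chains_def relation_of_def by auto
    show "\<exists>u\<in>?A. \<forall>a\<in>C. u \<le> a"
    proof (cases "C = {}")
      case True
      with N show ?thesis by auto
    next
      case False
      define u where "u v = (INF g\<in>C. g v)" for v
      have "- N (- v) \<le> g v" if "g \<in> C" for g v
        using sublinear_minus[of g v] that sub
        by (auto simp: le_fun_def intro: order_trans[rotated] dest!: subsetD[of C])
      then have "bdd_below ((\<lambda>g. g v) ` C)" for v
        by (intro bdd_belowI2)
      then have low: "u v \<le> g v" if "g \<in> C" for g v
        unfolding u_def using that by (intro cINF_lower)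
      have grt: "c \<le> u v" if "\<And>g. g \<in> C \<Longrightarrow> c \<le> g v" for c v
        unfolding u_def using that False by (intro cINF_greatest)
      have "u (v + w) \<le> g v + h w" if gh: "g \<in> C" "h \<in> C" for g h v w
      proof -
        obtain k where k: "k \<in> C" "k \<le> g" "k \<le> h"
          using tot[OF gh] gh by blast
        then have "u (v + w) \<le> k (v + w)"
          using low by blast
        also have "\<dots> \<le> k v + k w"
          using k sub sublinear_add by blast
        also have "\<dots> \<le> g v + h w"
          using k by (intro add_mono) (simp_all add: le_fun_def)
        finally show ?thesis .
      qed
      then have "u (v + w) - h w \<le> u v" if "h \<in> C" for h v w
        using that by (intro grt) (simp add: algebra_simps)
      then have "u (v + w) - u v \<le> u w" for v w
        by (intro grt) (simp add: algebra_simps)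
      moreover have "u (r *\<^sub>R v) \<le> r * u v" if r: "0 < r" for r v
      proof -
        have "u (r *\<^sub>R v) / r \<le> u v"
        proof (rule grt)
          fix g assume "g \<in> C"
          then have "u (r *\<^sub>R v) \<le> r * g v"
            using low[of g "r *\<^sub>R v"] sub sublinear_scaleR[of g r v] r by auto
          with r show "u (r *\<^sub>R v) / r \<le> g v"
            by (simp add: field_simps)
        qed
        with r show ?thesis by (simp add: field_simps)
      qed
      ultimately have "sublinear u"
        unfolding sublinear_def by (simp add: algebra_simps)
      moreover have "u \<le> N"
      proof -
        obtain g where "g \<in> C" using False by blast
        then have "u \<le> g" "g \<le> N"
          using low sub by (auto simp: le_fun_def)
        then show ?thesis by (rule order_trans)
      qed
      ultimately show ?thesis
        using low by (auto simp: le_fun_def)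
    qed
  qed
  then obtain m where m: "sublinear m" "m \<le> N"
    and "\<And>h. \<lbrakk>sublinear h; h \<le> N; h \<le> m\<rbrakk> \<Longrightarrow> h = m"
    by blast
  then have "linear m"
    by (intro linear_if_minimal_sublinear) (blast intro: order_trans)+
  with m that show thesis by (simp add: le_fun_def)
qed

lemma sublinear_infdist_cone:
  fixes K :: "'a::real_normed_vector set"
  assumes "0 \<in> K" and add: "\<And>v w. \<lbrakk>v \<in> K; w \<in> K\<rbrakk> \<Longrightarrow> v + w \<in> K"
    and scale: "\<And>r v. \<lbrakk>0 < r; v \<in> K\<rbrakk> \<Longrightarrow> r *\<^sub>R v \<in> K"
  shows "sublinear (\<lambda>v. infdist v K)"
proof -
  have "K \<noteq> {}" using \<open>0 \<in> K\<close> by blast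
  have grt: "c \<le> infdist v K" if "\<And>k. k \<in> K \<Longrightarrow> c \<le> norm (v - k)" for c v
    unfolding infdist_notempty[OF \<open>K \<noteq> {}\<close>] using that \<open>K \<noteq> {}\<close>
    by (intro cINF_greatest) (auto simp: dist_norm)
  have low: "infdist v K \<le> norm (v - k)" if "k \<in> K" for v k
    using infdist_le[OF that] by (simp add: dist_norm)
  have "infdist (v + w) K - norm (w - l) \<le> infdist v K" if "l \<in> K" for v w l
  proof (rule grt)
    fix k assume "k \<in> K"
    then have "infdist (v + w) K \<le> norm ((v - k) + (w - l))"
      using low[OF add, of k l "v + w"] that by (simp add: algebra_simps)
    then show "infdist (v + w) K - norm (w - l) \<le> norm (v - k)"
      using norm_triangle_ineq[of "v - k" "w - l"] by linarith
  qed
  then have "infdist (v + w) K - infdist v K \<le> norm (w - l)" if "l \<in> K" for v w l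
    using that by (simp add: algebra_simps)
  then have "infdist (v + w) K - infdist v K \<le> infdist w K" for v w
    by (rule grt)
  moreover have "infdist (r *\<^sub>R v) K \<le> r * infdist v K" if r: "0 < r" for r v
  proof -
    have "infdist (r *\<^sub>R v) K / r \<le> infdist v K"
    proof (rule grt)
      fix k assume "k \<in> K"
      then have "infdist (r *\<^sub>R v) K \<le> norm (r *\<^sub>R (v - k))"
        using low[OF scale[OF r], of k "r *\<^sub>R v"] by (simp only: scaleR_right_diff_distrib)
      with r show "infdist (r *\<^sub>R v) K / r \<le> norm (v - k)"
        by (simp add: pos_divide_le_eq mult.commute)
    qed
    with r show ?thesis by (simp add: field_simps)
  qed
  ultimately show ?thesis
    unfolding sublinear_def by (simp add: algebra_simps)
qed

text \<open>The distance to a convex cone is itself sublinear, so a linear functional below it that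
  attains it at \<open>q\<close> is automatically contractive and nonpositive on the cone.\<close>

lemma separation_from_cone:
  fixes K :: "'a::real_normed_vector set"
  assumes K: "0 \<in> K" "\<And>v w. \<lbrakk>v \<in> K; w \<in> K\<rbrakk> \<Longrightarrow> v + w \<in> K"
    "\<And>r v. \<lbrakk>0 < r; v \<in> K\<rbrakk> \<Longrightarrow> r *\<^sub>R v \<in> K"
  obtains f :: "'a \<Rightarrow> real" where "linear f" and "\<And>v. f v \<le> norm v"
    and "\<And>k. k \<in> K \<Longrightarrow> f k \<le> 0" and "infdist q K \<le> f q"
proof -
  let ?d = "\<lambda>v. infdist v K"
  have d: "sublinear ?d"
    by (rule sublinear_infdist_cone[OF K])
  obtain f where f: "linear f" and le: "\<And>v. f v \<le> lower_along ?d q v"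
    using linear_below_sublinear[OF sublinear_lower_along[OF d]] by blast
  have fd: "f v \<le> ?d v" for v
    using le lower_along_le_self[OF d] order_trans by blast
  show thesis
  proof (rule that[OF f])
    show "f v \<le> norm v" for v
      using fd[of v] infdist_le[OF K(1), of v] by simp
    show "f k \<le> 0" if "k \<in> K" for k
      using fd[of k] that by simp
    have "f (- q) \<le> - ?d q"
      using le[of "- q"] lower_along_le[OF d, of 1 q "- q"] by (simp add: sublinear_zero[OF d])
    then show "?d q \<le> f q"
      using linear_neg[OF f, of q] by simp
  qed
qed

section \<open>Elements of the predual\<close>

lemma Re_le_norm_blinfun:
  "Re (blinfun_apply F p) \<le> norm F * norm p" for F :: "'p::real_normed_vector \<Rightarrow>\<^sub>L complex"
  using complex_Re_le_cmod norm_blinfun order_trans by blast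

lemma cdual_nearly_norming:
  assumes F: "F \<in> cdual" and "c < norm F"
  obtains p where "norm p \<le> 1" and "c < Re (blinfun_apply F p)"
proof (rule ccontr)
  assume "\<not> thesis"
  with that have le: "Re (blinfun_apply F p) \<le> c" if "norm p \<le> 1" for p
    using that by fastforce
  have "norm F \<le> c"
  proof (rule norm_blinfun_bound)
    show "0 \<le> c" using le[of 0] by (simp add: blinfun.zero_right)
    fix v
    show "cmod (blinfun_apply F v) \<le> c * norm v"
    proof (cases "v = 0")
      case False
      obtain a where a: "cmod a = 1"
        and Fa: "blinfun_apply F (a *\<^sub>C v) = complex_of_real (cmod (blinfun_apply F v))"
        using F unfolding cdual_def clinear_on_def scaleC_complex_def
        by (auto intro: scaleC_rotate[of "blinfun_apply F" v])
      have "norm ((a *\<^sub>C v) /\<^sub>R norm v) \<le> 1"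
        using a False by (simp add: norm_scaleC)
      from le[OF this] show ?thesis
        using False by (simp add: blinfun.scaleR_right Fa field_simps)
    qed (simp add: blinfun.zero_right)
  qed
  with \<open>c < norm F\<close> show False by simp
qed

text \<open>The complex functional is \<open>v \<mapsto> f v - \<i> f (\<i> v)\<close>. Its modulus at \<open>v\<close> is its real part at a
  rotation of \<open>v\<close>, so that a bound on \<open>f\<close> passes to it with the same constant.\<close>

lemma cdual_of_Re:
  fixes f :: "'p::complex_normed_vector \<Rightarrow> real"
  assumes f: "linear f" and le: "\<And>v. f v \<le> norm v"
  obtains F where "F \<in> cdual" and "norm F \<le> 1" and "\<And>v. Re (blinfun_apply F v) = f v"
proof -
  define h where "h v = Complex (f v) (- f (\<i> *\<^sub>C v))" for v
  have add: "h (v + w) = h v + h w" for v w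
    unfolding h_def by (simp add: scaleC_add_right linear_add[OF f] complex_eq_iff)
  have scale: "h (a *\<^sub>C v) = a * h v" for a v
  proof -
    have "a *\<^sub>C v = Re a *\<^sub>R v + Im a *\<^sub>R (\<i> *\<^sub>C v)"
      unfolding scaleR_scaleC scaleC_scaleC scaleC_add_left[symmetric]
      by (simp add: complex_eq mult.commute)
    moreover have "\<i> *\<^sub>C (a *\<^sub>C v) = (- Im a) *\<^sub>R v + Re a *\<^sub>R (\<i> *\<^sub>C v)"
    proof -
      have "\<i> * a = complex_of_real (- Im a) + complex_of_real (Re a) * \<i>"
        by (simp add: complex_eq_iff)
      then show ?thesis
        unfolding scaleR_scaleC scaleC_scaleC scaleC_add_left[symmetric] by simp
    qed
    ultimately show ?thesis
      unfolding h_def by (simp add: linear_add[OF f] linear_scale[OF f] linear_neg[OF f] linear_diff[OF f] complex_eq_iff)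
  qed
  have bound: "cmod (h v) \<le> norm v" for v
  proof -
    obtain c where c: "cmod c = 1" "h (c *\<^sub>C v) = complex_of_real (cmod (h v))"
      using scaleC_rotate[of h v] scale by blast
    have "cmod (h v) = Re (h (c *\<^sub>C v))"
      by (simp add: c)
    also have "\<dots> \<le> norm (c *\<^sub>C v)"
      using le by (simp add: h_def)
    finally show ?thesis
      by (simp add: norm_scaleC c)
  qed
  have "bounded_linear h"
  proof (rule bounded_linear_intro[of _ 1])
    show "h (r *\<^sub>R v) = r *\<^sub>R h v" for r v
      by (simp add: scaleR_scaleC scale scaleC_complex_def)
  qed (simp_all add: add bound)
  then have "blinfun_apply (Blinfun h) = h"
    by (rule bounded_linear_Blinfun_apply)
  then show thesis
    using add scale bound
    by (intro that[of "Blinfun h"] norm_blinfun_bound)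
      (simp_all add: cdual_def clinear_on_def scaleC_complex_def h_def)
qed

text \<open>With the unit as \<open>e\<close>, for \<open>\<delta> = 0\<close> this is the cone generated by the
  states in the predual; for \<open>\<delta> > 0\<close>, the cone of its approximate members.\<close>

definition approx_positive :: "('p::real_normed_vector \<Rightarrow>\<^sub>L complex) \<Rightarrow> real \<Rightarrow> 'p set"
  where "approx_positive e \<delta> = {p. (1 - \<delta>) * norm p \<le> Re (blinfun_apply e p)}"

lemma approx_positive_cone:
  assumes "\<delta> \<le> 1"
  shows "0 \<in> approx_positive e \<delta>"
    and "\<lbrakk>p \<in> approx_positive e \<delta>; q \<in> approx_positive e \<delta>\<rbrakk> \<Longrightarrow> p + q \<in> approx_positive e \<delta>"
    and "\<lbrakk>0 < r; p \<in> approx_positive e \<delta>\<rbrakk> \<Longrightarrow> r *\<^sub>R p \<in> approx_positive e \<delta>"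
proof -
  show "0 \<in> approx_positive e \<delta>"
    by (simp add: approx_positive_def blinfun.zero_right)
  {
    assume "p \<in> approx_positive e \<delta>" "q \<in> approx_positive e \<delta>"
    moreover have "(1 - \<delta>) * norm (p + q) \<le> (1 - \<delta>) * (norm p + norm q)"
      using assms by (intro mult_left_mono norm_triangle_ineq) simp
    ultimately show "p + q \<in> approx_positive e \<delta>"
      by (simp add: approx_positive_def blinfun.add_right algebra_simps)
  }
  assume r: "0 < r" and "p \<in> approx_positive e \<delta>"
  then have "r * ((1 - \<delta>) * norm p) \<le> r * Re (blinfun_apply e p)"
    by (simp add: approx_positive_def)
  with r show "r *\<^sub>R p \<in> approx_positive e \<delta>"
    by (simp add: approx_positive_def blinfun.scaleR_right algebra_simps)
qed

lemma predual_add_scaleR: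
  assumes X: "unital_operator_space X" and P: "is_predual X \<Phi>" and x: "x \<in> X"
  shows "\<Phi> (id_blinfun + t *\<^sub>R x) = \<Phi> id_blinfun + t *\<^sub>R \<Phi> x"
proof -
  have "id_blinfun \<in> X" and "complex_of_real t *\<^sub>C x \<in> X"
    using X x unfolding unital_operator_space_def by (auto intro: complex_vector.subspace_scale)
  moreover have lin: "clinear_on X \<Phi>"
    using P unfolding is_predual_def by blast
  ultimately have "\<Phi> (id_blinfun + complex_of_real t *\<^sub>C x)
      = \<Phi> id_blinfun + \<Phi> (complex_of_real t *\<^sub>C x)"
    unfolding clinear_on_def by blast
  also have "\<Phi> (complex_of_real t *\<^sub>C x) = complex_of_real t *\<^sub>C \<Phi> x"
    using lin x unfolding clinear_on_def by blast
  finally show ?thesis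
    by (simp add: scaleR_scaleC)
qed

lemma predual_Re_add_scaleR_le:
  assumes X: "unital_operator_space X" and P: "is_predual X \<Phi>" and x: "x \<in> X"
  shows "Re (blinfun_apply (\<Phi> id_blinfun) p) + t * Re (blinfun_apply (\<Phi> x) p)
    \<le> norm (id_blinfun + t *\<^sub>R x) * norm p"
proof -
  have "norm (\<Phi> (id_blinfun + t *\<^sub>R x)) = norm (id_blinfun + t *\<^sub>R x)"
    using P unital_operator_space_add_scaleR[OF X x] unfolding is_predual_def by blast
  with Re_le_norm_blinfun[of "\<Phi> (id_blinfun + t *\<^sub>R x)" p] show ?thesis
    unfolding predual_add_scaleR[OF X P x] by (simp add: blinfun.add_left blinfun.scaleR_left)
qed

lemma predual_nearly_norming:
  assumes X: "unital_operator_space X" and P: "is_predual X \<Phi>" and x: "x \<in> X"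
    and c: "c < norm (id_blinfun + t *\<^sub>R x)"
  obtains p where "norm p \<le> 1"
    and "c < Re (blinfun_apply (\<Phi> id_blinfun) p) + t * Re (blinfun_apply (\<Phi> x) p)"
proof -
  let ?y = "id_blinfun + t *\<^sub>R x"
  have "?y \<in> X"
    by (rule unital_operator_space_add_scaleR[OF X x])
  then have "\<Phi> ?y \<in> cdual" and "norm (\<Phi> ?y) = norm ?y"
    using P unfolding is_predual_def bij_betw_def by auto
  then obtain p where "norm p \<le> 1" "c < Re (blinfun_apply (\<Phi> ?y) p)"
    using c cdual_nearly_norming[of "\<Phi> ?y" c] by metis
  then show thesis
    unfolding predual_add_scaleR[OF X P x]
    by (intro that) (simp_all add: blinfun.add_left blinfun.scaleR_left)
qed

lemma predual_norm_unit_le: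
  assumes X: "unital_operator_space X" and P: "is_predual X \<Phi>"
  shows "norm (\<Phi> id_blinfun) \<le> 1"
proof -
  have "norm (\<Phi> id_blinfun) = norm (id_blinfun :: 'a \<Rightarrow>\<^sub>L 'a)"
    using X P unfolding is_predual_def unital_operator_space_def by blast
  also have "\<dots> \<le> 1"
    by (rule norm_blinfun_bound) simp_all
  finally show ?thesis .
qed

text \<open>On \<open>1 + t y\<close> the real part of \<open>q\<close> is at most \<open>(1 + t\<^sup>2 \<parallel>y\<parallel>\<^sup>2 / 2) \<parallel>q\<parallel>\<close>, of which approximate
  positivity already uses up \<open>(1 - \<delta>) \<parallel>q\<parallel>\<close> at the unit; the rest bounds \<open>t Re q(y)\<close>.\<close>

lemma dissipative_Re_le:
  assumes X: "unital_operator_space X" and P: "is_predual X \<Phi>"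
    and y: "y \<in> X" "dissipative X y" and t: "0 < t"
    and q: "q \<in> approx_positive (\<Phi> id_blinfun) \<delta>"
  shows "Re (blinfun_apply (\<Phi> y) q) \<le> norm q * (\<delta> / t + t * (norm y)\<^sup>2 / 2)"
proof -
  have "(norm (id_blinfun + t *\<^sub>R y))\<^sup>2 \<le> 1 + t\<^sup>2 * (norm y)\<^sup>2"
    using dissipative_imp_norm_le[OF X y(2)] t by simp
  also have "\<dots> \<le> (1 + t\<^sup>2 * (norm y)\<^sup>2 / 2)\<^sup>2"
    using zero_le_power2[of "t\<^sup>2 * (norm y)\<^sup>2"] by (simp add: power2_eq_square algebra_simps)
  finally have "norm (id_blinfun + t *\<^sub>R y) \<le> 1 + t\<^sup>2 * (norm y)\<^sup>2 / 2"
    by (rule power2_le_imp_le) simp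
  then have "norm (id_blinfun + t *\<^sub>R y) * norm q \<le> (1 + t\<^sup>2 * (norm y)\<^sup>2 / 2) * norm q"
    by (intro mult_right_mono) simp_all
  then have "(1 - \<delta>) * norm q + t * Re (blinfun_apply (\<Phi> y) q)
      \<le> (1 + t\<^sup>2 * (norm y)\<^sup>2 / 2) * norm q"
    using predual_Re_add_scaleR_le[OF X P y(1), of q t] q by (simp add: approx_positive_def)
  then have "t * Re (blinfun_apply (\<Phi> y) q) \<le> norm q * (\<delta> + t\<^sup>2 * (norm y)\<^sup>2 / 2)"
    by (simp add: algebra_simps)
  with t show ?thesis
    by (simp add: field_simps power2_eq_square)
qed

text \<open>Members of the limiting cone are nonnegative multiples of states, so they inherit the sign.\<close>

lemma dissipative_Re_nonpos:
  assumes X: "unital_operator_space X" and P: "is_predual X \<Phi>"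
    and y: "y \<in> X" "dissipative X y" and q: "q \<in> approx_positive (\<Phi> id_blinfun) 0"
  shows "Re (blinfun_apply (\<Phi> y) q) \<le> 0"
proof -
  have "((\<lambda>t. norm q * (t * (norm y)\<^sup>2 / 2)) \<longlongrightarrow> norm q * (0 * (norm y)\<^sup>2 / 2)) (at_right 0)"
    by (intro tendsto_intros) simp
  moreover have "\<forall>\<^sub>F t in at_right 0. Re (blinfun_apply (\<Phi> y) q) \<le> norm q * (t * (norm y)\<^sup>2 / 2)"
    using dissipative_Re_le[OF X P y _ q]
    by (auto simp: eventually_at_right_field intro!: exI[of _ 1])
  ultimately have "Re (blinfun_apply (\<Phi> y) q) \<le> norm q * (0 * (norm y)\<^sup>2 / 2)"
    by (rule tendsto_lowerbound) simp
  then show ?thesis by simp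
qed

text \<open>The reason is that \<open>\<parallel>1 + t x\<parallel> \<le> 1\<close> for \<open>t \<le> \<delta>\<close>: a vector \<open>p\<close> of the unit ball of the
  predual either lies in the cone, where \<open>t x\<close> contributes nothing positive, or has
  \<open>Re p(1) < 1 - \<delta>\<close>, which a perturbation of norm at most \<open>t\<close> cannot raise above one.\<close>

lemma dissipative_if_nonpos_on_cone:
  assumes X: "unital_operator_space X" and P: "is_predual X \<Phi>"
    and x: "x \<in> X" "norm x \<le> 1" and \<delta>: "0 < \<delta>" "\<delta> \<le> 1"
    and le: "\<And>p. p \<in> approx_positive (\<Phi> id_blinfun) \<delta> \<Longrightarrow> Re (blinfun_apply (\<Phi> x) p) \<le> 0"
  shows "dissipative X x"
proof (rule dissipative_if_norm_le[OF X x(1) \<delta>(1), of 0])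
  let ?e = "\<Phi> id_blinfun"
  fix t assume t: "0 < t" "t \<le> \<delta>"
  have "norm (id_blinfun + t *\<^sub>R x) \<le> 1"
  proof (rule ccontr)
    assume "\<not> ?thesis"
    then obtain p where p: "norm p \<le> 1"
      and gt: "1 < Re (blinfun_apply ?e p) + t * Re (blinfun_apply (\<Phi> x) p)"
      using predual_nearly_norming[OF X P x(1), of 1 t] by auto
    have "norm ?e * norm p \<le> 1 * 1"
      using predual_norm_unit_le[OF X P] p by (intro mult_mono) auto
    then have "Re (blinfun_apply ?e p) \<le> 1"
      using Re_le_norm_blinfun[of ?e p] by simp
    then have pos: "0 < Re (blinfun_apply (\<Phi> x) p)"
      using gt t by (smt (verit) mult_nonneg_nonpos)
    have "norm (\<Phi> x) * norm p \<le> 1 * 1"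
      using P x p unfolding is_predual_def by (intro mult_mono) auto
    then have "Re (blinfun_apply (\<Phi> x) p) \<le> 1"
      using Re_le_norm_blinfun[of "\<Phi> x" p] by simp
    then have "t * Re (blinfun_apply (\<Phi> x) p) \<le> \<delta> * 1"
      using t pos by (intro mult_mono) auto
    then have "1 - \<delta> \<le> Re (blinfun_apply ?e p)"
      using gt by simp
    moreover have "(1 - \<delta>) * norm p \<le> (1 - \<delta>) * 1"
      using p \<delta> by (intro mult_left_mono) auto
    ultimately have "p \<in> approx_positive ?e \<delta>"
      by (simp add: approx_positive_def)
    with le pos show False by fastforce
  qed
  then show "(norm (id_blinfun + t *\<^sub>R x))\<^sup>2 \<le> 1 + 0 * t\<^sup>2"
    by (simp add: power_le_one)
qed

text \<open>The estimate does not depend on \<open>\<epsilon>\<close>, for the separating functional is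
  a dissipative contraction, whatever \<open>\<epsilon>\<close> is, and on those the real part of \<open>q\<close> is
  at most of order \<open>sqrt \<delta> \<parallel>q\<parallel>\<close>.\<close>

lemma infdist_approx_positive_le:
  fixes \<Phi> :: "('h::{complex_inner, complete_space} \<Rightarrow>\<^sub>L 'h) \<Rightarrow>
    ('p::{complex_normed_vector, complete_space} \<Rightarrow>\<^sub>L complex)"
  assumes X: "unital_operator_space X" and P: "is_predual X \<Phi>"
    and \<epsilon>: "0 < \<epsilon>" "\<epsilon> \<le> 1" and \<delta>: "0 < \<delta>" and q: "q \<in> approx_positive (\<Phi> id_blinfun) \<delta>"
  shows "infdist q (approx_positive (\<Phi> id_blinfun) \<epsilon>) \<le> 3 / 2 * sqrt \<delta> * norm q"
proof -
  let ?K = "approx_positive (\<Phi> id_blinfun) \<epsilon>"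
  obtain f :: "'p \<Rightarrow> real" where f: "linear f" "\<And>v. f v \<le> norm v"
    and neg: "\<And>k. k \<in> ?K \<Longrightarrow> f k \<le> 0" and sep: "infdist q ?K \<le> f q"
    using separation_from_cone[of ?K q] approx_positive_cone[OF \<epsilon>(2)] by metis
  obtain F where F: "F \<in> cdual" "norm F \<le> 1" and Re: "\<And>v. Re (blinfun_apply F v) = f v"
    using cdual_of_Re[OF f] by blast
  have "F \<in> \<Phi> ` X"
    using P F(1) unfolding is_predual_def bij_betw_def by simp
  then obtain x where x: "x \<in> X" and \<Phi>x: "\<Phi> x = F"
    by blast
  have nx: "norm x \<le> 1"
    using P x F \<Phi>x unfolding is_predual_def by metis
  have diss: "dissipative X x"
    by (rule dissipative_if_nonpos_on_cone[OF X P x nx \<epsilon>]) (simp add: \<Phi>x Re neg)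
  \<comment> \<open>The value \<open>t = sqrt \<delta>\<close> balances \<open>\<delta> / t\<close> against \<open>t / 2\<close>.\<close>
  have "f q \<le> norm q * (\<delta> / sqrt \<delta> + sqrt \<delta> * (norm x)\<^sup>2 / 2)"
    using dissipative_Re_le[OF X P x diss _ q, of "sqrt \<delta>"] \<delta> by (simp add: \<Phi>x Re)
  also have "\<dots> \<le> norm q * (sqrt \<delta> + sqrt \<delta> * 1 / 2)"
    using nx \<delta> by (intro mult_left_mono add_mono divide_right_mono)
      (simp_all add: real_div_sqrt power_le_one)
  finally show ?thesis
    using sep by (simp add: algebra_simps)
qed

text \<open>Approximate positivity improves to exact positivity by successive corrections: the
  \<open>n\<close>-th has size at most \<open>4 \<epsilon> / 2 ^ n\<close>, so their sum converges and has norm at most \<open>8 \<epsilon>\<close>.\<close>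

lemma positive_near_approx_positive:
  fixes \<Phi> :: "('h::{complex_inner, complete_space} \<Rightarrow>\<^sub>L 'h) \<Rightarrow>
    ('p::{complex_normed_vector, complete_space} \<Rightarrow>\<^sub>L complex)"
  assumes X: "unital_operator_space X" and P: "is_predual X \<Phi>"
    and \<epsilon>: "0 < \<epsilon>" "\<epsilon> \<le> 1 / 8"
    and p: "p \<in> approx_positive (\<Phi> id_blinfun) (\<epsilon>\<^sup>2)" "norm p \<le> 1"
  obtains p' where "p' \<in> approx_positive (\<Phi> id_blinfun) 0" and "norm (p' - p) \<le> 8 * \<epsilon>"
proof -
  let ?e = "\<Phi> id_blinfun"
  define \<delta> where "\<delta> n = (\<epsilon> / 2 ^ n)\<^sup>2" for n :: nat
  have \<delta>: "0 < \<delta> n" "\<delta> n \<le> 1" "sqrt (\<delta> n) = \<epsilon> / 2 ^ n" for n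
  proof -
    show "0 < \<delta> n" "sqrt (\<delta> n) = \<epsilon> / 2 ^ n"
      using \<epsilon> by (simp_all add: \<delta>_def)
    have "1 * \<epsilon> \<le> 2 ^ n * 1"
      using \<epsilon> by (intro mult_mono) auto
    then show "\<delta> n \<le> 1"
      unfolding \<delta>_def using \<epsilon> by (intro power_le_one) (simp_all add: field_simps)
  qed
  \<comment> \<open>The bound \<open>norm q \<le> 2\<close>, which makes the corrections geometric, is kept by the second
    conjunct.\<close>
  let ?I = "\<lambda>n q. q \<in> approx_positive ?e (\<delta> n) \<and> norm (q - p) \<le> 8 * \<epsilon> * (1 - 1 / 2 ^ n)"
  let ?S = "\<lambda>n q q'. norm (q' - q) \<le> 4 * \<epsilon> / 2 ^ n"
  have "\<exists>q. \<forall>n. ?I n (q n) \<and> ?S n (q n) (q (Suc n))"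
  proof (rule dependent_nat_choice)
    show "\<exists>q. ?I 0 q"
      using p by (intro exI[of _ p]) (simp add: \<delta>_def)
    fix q n assume I: "?I n q"
    have "8 * \<epsilon> * (1 - 1 / 2 ^ n) \<le> 1 * 1"
      using \<epsilon> by (intro mult_mono) auto
    then have "norm q \<le> 2"
      using I p norm_triangle_ineq[of "q - p" p] by simp
    then have "3 / 2 * sqrt (\<delta> n) * norm q \<le> 3 / 2 * sqrt (\<delta> n) * 2"
      using \<delta>(1)[of n] by (intro mult_left_mono) simp_all
    then have "infdist q (approx_positive ?e (\<delta> (Suc n))) \<le> 3 * (\<epsilon> / 2 ^ n)"
      using infdist_approx_positive_le[OF X P \<delta>(1)[of "Suc n"] \<delta>(2) \<delta>(1)[of n], of q] I
      by (simp add: \<delta>(3))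
    also have "\<dots> < 4 * \<epsilon> / 2 ^ n"
      using \<epsilon> by (simp add: field_simps)
    finally have "\<exists>q'\<in>approx_positive ?e (\<delta> (Suc n)). dist q q' < 4 * \<epsilon> / 2 ^ n"
      using approx_positive_cone(1)[OF \<delta>(2), of ?e "Suc n"]
      by (subst (asm) infdist_notempty) (auto dest!: cInf_lessD[rotated])
    then obtain q' where q': "q' \<in> approx_positive ?e (\<delta> (Suc n))" "?S n q q'"
      by (auto simp: dist_norm norm_minus_commute)
    moreover have "norm (q' - p) \<le> 8 * \<epsilon> * (1 - 1 / 2 ^ Suc n)"
    proof -
      have "norm (q' - p) \<le> 4 * \<epsilon> / 2 ^ n + 8 * \<epsilon> * (1 - 1 / 2 ^ n)"
        using norm_triangle_ineq[of "q' - q" "q - p"] q'(2) I by simp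
      also have "\<dots> = 8 * \<epsilon> * (1 - 1 / 2 ^ Suc n)"
        by (simp add: field_simps)
      finally show ?thesis .
    qed
    ultimately show "\<exists>q'. ?I (Suc n) q' \<and> ?S n q q'"
      by blast
  qed
  then obtain q where I: "\<And>n. ?I n (q n)" and S: "\<And>n. ?S n (q n) (q (Suc n))"
    by blast
  have tail: "norm (q (m + k) - q m) \<le> 8 * \<epsilon> * (1 / 2 ^ m - 1 / 2 ^ (m + k))" for m k
  proof (induction k)
    case (Suc k)
    have "norm (q (m + Suc k) - q m)
        \<le> 4 * \<epsilon> / 2 ^ (m + k) + 8 * \<epsilon> * (1 / 2 ^ m - 1 / 2 ^ (m + k))"
      using norm_triangle_ineq[of "q (Suc (m + k)) - q (m + k)" "q (m + k) - q m"]
        S[of "m + k"] Suc by simp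
    also have "\<dots> = 8 * \<epsilon> * (1 / 2 ^ m - 1 / 2 ^ (m + Suc k))"
      by (simp add: field_simps)
    finally show ?case .
  qed simp
  have pow: "(\<lambda>n. c / 2 ^ n) \<longlonglongrightarrow> 0" for c :: real
    using tendsto_mult_right_zero[OF LIMSEQ_realpow_zero[of "1 / 2"], of c]
    by (simp add: power_divide)
  have "Cauchy q"
  proof (rule CauchyI')
    fix r :: real assume "0 < r"
    with pow[of "8 * \<epsilon>"] obtain M where M: "\<And>m. M \<le> m \<Longrightarrow> 8 * \<epsilon> / 2 ^ m < r"
      unfolding LIMSEQ_iff using \<epsilon> by fastforce
    have "dist (q m) (q n) < r" if "M \<le> m" "m < n" for m n
    proof -
      obtain k where n: "n = m + k"
        using \<open>m < n\<close> less_imp_add_positive by blast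
      have "dist (q m) (q n) \<le> 8 * \<epsilon> * (1 / 2 ^ m - 1 / 2 ^ (m + k))"
        using tail[of m k] by (simp add: n dist_norm norm_minus_commute)
      also have "\<dots> \<le> 8 * \<epsilon> / 2 ^ m"
        using \<epsilon> by (simp add: field_simps)
      finally show ?thesis
        using M[OF \<open>M \<le> m\<close>] by simp
    qed
    then show "\<exists>M. \<forall>m\<ge>M. \<forall>n>m. dist (q m) (q n) < r"
      by blast
  qed
  then obtain p' where lim: "q \<longlonglongrightarrow> p'"
    using Cauchy_convergent_iff convergent_def by blast
  have "\<delta> \<longlonglongrightarrow> 0\<^sup>2"
    unfolding \<delta>_def by (intro tendsto_power pow)
  then have "(\<lambda>n. (1 - \<delta> n) * norm (q n)) \<longlonglongrightarrow> (1 - 0\<^sup>2) * norm p'"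
    by (intro tendsto_intros lim)
  moreover have "(\<lambda>n. Re (blinfun_apply ?e (q n))) \<longlonglongrightarrow> Re (blinfun_apply ?e p')"
    by (intro tendsto_intros lim)
  ultimately have "(1 - 0\<^sup>2) * norm p' \<le> Re (blinfun_apply ?e p')"
    using I by (intro LIMSEQ_le) (auto simp: approx_positive_def)
  moreover have "norm (p' - p) \<le> 8 * \<epsilon>"
  proof (rule LIMSEQ_le_const2)
    show "(\<lambda>n. norm (q n - p)) \<longlonglongrightarrow> norm (p' - p)"
      by (intro tendsto_intros lim)
    have "norm (q n - p) \<le> 8 * \<epsilon>" for n
    proof -
      have "8 * \<epsilon> * (1 - 1 / 2 ^ n) \<le> 8 * \<epsilon> * 1"
        using \<epsilon> by (intro mult_left_mono) auto
      with I[of n] show ?thesis by simp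
    qed
    then show "\<exists>N. \<forall>n\<ge>N. norm (q n - p) \<le> 8 * \<epsilon>" by blast
  qed
  ultimately show thesis
    by (intro that[of p']) (simp_all add: approx_positive_def)
qed

section \<open>Weak* closedness\<close>

text \<open>If a state has \<open>Re \<rho>(x) = \<alpha> > 0\<close>, then \<open>\<parallel>1 + t x\<parallel> \<ge> 1 + t \<alpha>\<close>. A
  vector \<open>p\<close> of the unit ball of the predual that nearly norms \<open>1 + t x\<close> is positive up to \<open>\<delta> = t \<parallel>x\<parallel>\<close> and has real part
  at least \<open>\<alpha> / 2\<close> at \<open>x\<close>; making it positive costs only \<open>O(sqrt \<delta>)\<close>.\<close>

lemma not_dissipative_detected_by_predual:
  fixes \<Phi> :: "('h::{complex_inner, complete_space} \<Rightarrow>\<^sub>L 'h) \<Rightarrow>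
    ('p::{complex_normed_vector, complete_space} \<Rightarrow>\<^sub>L complex)"
  assumes X: "unital_operator_space X" and P: "is_predual X \<Phi>"
    and x: "x \<in> X" "\<not> dissipative X x"
  obtains p where "p \<in> approx_positive (\<Phi> id_blinfun) 0" and "0 < Re (blinfun_apply (\<Phi> x) p)"
proof -
  let ?e = "\<Phi> id_blinfun"
  obtain \<rho> where \<rho>: "state_on X \<rho>" and "0 < Re (\<rho> x)"
    using x(2) unfolding dissipative_def numerical_range_def by fastforce
  define \<alpha> where "\<alpha> = Re (\<rho> x)"
  have \<alpha>: "0 < \<alpha>" "\<alpha> \<le> norm x"
    using \<open>0 < Re (\<rho> x)\<close> complex_Re_le_cmod[of "\<rho> x"] state_on_cmod_le[OF X \<rho> x(1)]
    by (simp_all add: \<alpha>_def)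
  then have "0 < norm x" by linarith
  define \<epsilon> where "\<epsilon> = min (1 / 8) (\<alpha> / (32 * norm x))"
  define t where "t = \<epsilon>\<^sup>2 / norm x"
  have \<epsilon>: "0 < \<epsilon>" "\<epsilon> \<le> 1 / 8" and \<epsilon>x: "8 * \<epsilon> * norm x \<le> \<alpha> / 4"
  proof -
    show "0 < \<epsilon>" "\<epsilon> \<le> 1 / 8"
      using \<alpha> \<open>0 < norm x\<close> by (simp_all add: \<epsilon>_def)
    have "\<epsilon> \<le> \<alpha> / (32 * norm x)"
      by (simp add: \<epsilon>_def)
    with \<open>0 < norm x\<close> show "8 * \<epsilon> * norm x \<le> \<alpha> / 4"
      by (simp add: field_simps)
  qed
  have t: "0 < t" "t * norm x = \<epsilon>\<^sup>2"
    using \<epsilon> \<open>0 < norm x\<close> by (simp_all add: t_def)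
  have nx: "norm (\<Phi> x) = norm x"
    using P x unfolding is_predual_def by blast
  have "1 + t * \<alpha> / 2 < 1 + t * \<alpha>"
    using t \<alpha> by simp
  also have "\<dots> = Re (\<rho> (id_blinfun + t *\<^sub>R x))"
    by (simp add: state_on_add_scaleR[OF X \<rho> x(1)] \<alpha>_def)
  also have "\<dots> \<le> norm (id_blinfun + t *\<^sub>R x)"
    using complex_Re_le_cmod state_on_cmod_le[OF X \<rho> unital_operator_space_add_scaleR[OF X x(1)]]
      order_trans by blast
  finally obtain p where p: "norm p \<le> 1"
    and gt: "1 + t * \<alpha> / 2 < Re (blinfun_apply ?e p) + t * Re (blinfun_apply (\<Phi> x) p)"
    using predual_nearly_norming[OF X P x(1)] by metis
  have "norm ?e * norm p \<le> 1 * 1"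
    using predual_norm_unit_le[OF X P] p by (intro mult_mono) auto
  then have "Re (blinfun_apply ?e p) \<le> 1"
    using Re_le_norm_blinfun[of ?e p] by simp
  with gt have "t * (\<alpha> / 2) < t * Re (blinfun_apply (\<Phi> x) p)"
    by simp
  then have half: "\<alpha> / 2 < Re (blinfun_apply (\<Phi> x) p)"
    using t by simp
  have "norm (\<Phi> x) * norm p \<le> norm x * 1"
    using p nx by (intro mult_mono) auto
  then have "Re (blinfun_apply (\<Phi> x) p) \<le> norm x"
    using Re_le_norm_blinfun[of "\<Phi> x" p] by simp
  then have "t * Re (blinfun_apply (\<Phi> x) p) \<le> \<epsilon>\<^sup>2"
    using t by (metis mult_left_mono less_imp_le)
  then have "1 - \<epsilon>\<^sup>2 \<le> Re (blinfun_apply ?e p)"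
    using gt t \<alpha> by (smt (verit) divide_nonneg_nonneg mult_nonneg_nonneg)
  moreover have "(1 - \<epsilon>\<^sup>2) * norm p \<le> (1 - \<epsilon>\<^sup>2) * 1"
    using p \<epsilon> by (intro mult_left_mono) (simp_all add: power_le_one)
  ultimately have "p \<in> approx_positive ?e (\<epsilon>\<^sup>2)"
    by (simp add: approx_positive_def)
  then obtain p' where p': "p' \<in> approx_positive ?e 0" "norm (p' - p) \<le> 8 * \<epsilon>"
    using positive_near_approx_positive[OF X P \<epsilon> _ p] by blast
  have "Re (blinfun_apply (\<Phi> x) (p - p')) \<le> norm x * norm (p - p')"
    using Re_le_norm_blinfun[of "\<Phi> x" "p - p'"] nx by simp
  also have "\<dots> \<le> norm x * (8 * \<epsilon>)"
    using p'(2) by (intro mult_left_mono) (simp_all add: norm_minus_commute)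
  also have "\<dots> \<le> \<alpha> / 4"
    using \<epsilon>x by (simp add: mult.commute)
  finally have "0 < Re (blinfun_apply (\<Phi> x) p')"
    using half \<alpha> by (simp add: blinfun.diff_right)
  with p' that show thesis by blast
qed

lemma closedin_dissipative:
  fixes \<Phi> :: "('h::{complex_inner, complete_space} \<Rightarrow>\<^sub>L 'h) \<Rightarrow>
    ('p::{complex_normed_vector, complete_space} \<Rightarrow>\<^sub>L complex)"
  assumes X: "unital_operator_space X" and P: "is_predual X \<Phi>"
  shows "closedin (weak_star_topology X \<Phi>) {x \<in> X. dissipative X x}"
proof -
  let ?T = "weak_star_topology X \<Phi>" and ?G = "\<lambda>p U. {x \<in> X. blinfun_apply (\<Phi> x) p \<in> U}"
  have basic: "openin ?T (?G p U)" if "open U" for p U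
    unfolding weak_star_topology_def using that by (intro topology_generated_by_Basis) blast
  have top: "topspace ?T = X"
  proof
    show "topspace ?T \<subseteq> X"
      unfolding weak_star_topology_def by auto
    show "X \<subseteq> topspace ?T"
      using openin_subset[OF basic[of UNIV 0]] by auto
  qed
  have "openin ?T (X - {x \<in> X. dissipative X x})"
  proof (subst openin_subopen, intro ballI)
    fix x assume "x \<in> X - {x \<in> X. dissipative X x}"
    then have x: "x \<in> X" "\<not> dissipative X x" by auto
    obtain p where p: "p \<in> approx_positive (\<Phi> id_blinfun) 0" "0 < Re (blinfun_apply (\<Phi> x) p)"
      by (rule not_dissipative_detected_by_predual[OF X P x])
    have "?G p {z. 0 < Re z} \<subseteq> X - {x \<in> X. dissipative X x}"
      using dissipative_Re_nonpos[OF X P _ _ p(1)] by fastforce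
    then show "\<exists>V. openin ?T V \<and> x \<in> V \<and> V \<subseteq> X - {x \<in> X. dissipative X x}"
      using basic[OF open_halfspace_Re_gt[of 0], of p] x p
      by (intro exI[of _ "?G p {z. 0 < Re z}"]) auto
  qed
  then show ?thesis
    by (auto simp: closedin_def top)
qed

theorem lemma2p5:
  fixes X :: "('h::{complex_inner, complete_space} \<Rightarrow>\<^sub>L 'h) set"
  assumes "unital_operator_space X"
  shows "(\<forall>x\<in>X. norm x \<le> 1 \<longrightarrow>
            (dissipative X x \<longleftrightarrow>
              (\<forall>t\<in>{0..1::real}. (norm (id_blinfun + t *\<^sub>R x))\<^sup>2 \<le> 1 + t\<^sup>2)))
       \<and> (\<forall>\<Phi> :: ('h \<Rightarrow>\<^sub>L 'h) \<Rightarrow> ('p::{complex_normed_vector, complete_space} \<Rightarrow>\<^sub>L complex).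
            is_predual X \<Phi> \<longrightarrow>
            closedin (weak_star_topology X \<Phi>) {x\<in>X. dissipative X x})"
proof (intro conjI ballI allI impI iffI)
  fix x t assume x: "x \<in> X" "norm x \<le> 1" "dissipative X x" and t: "t \<in> {0..1::real}"
  have "t\<^sup>2 * (norm x)\<^sup>2 \<le> t\<^sup>2 * 1"
    using x by (intro mult_left_mono) (simp_all add: power_le_one)
  then show "(norm (id_blinfun + t *\<^sub>R x))\<^sup>2 \<le> 1 + t\<^sup>2"
    using dissipative_imp_norm_le[OF assms x(3), of t] t by simp
next
  fix x assume "x \<in> X" "\<forall>t\<in>{0..1::real}. (norm (id_blinfun + t *\<^sub>R x))\<^sup>2 \<le> 1 + t\<^sup>2"
  then show "dissipative X x"
    by (intro dissipative_if_norm_le[OF assms, of x 1 1]) auto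
qed (rule closedin_dissipative[OF assms])

end
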